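(* Let $D=\{1,\dots,d\}$ with $d\ge2$, let $(V_\alpha,\langle\cdot,\cdot\rangle_\alpha)$ be a Hilbert space for each $\alpha\in D$, let $\mathbf V={}_a\bigotimes_{\alpha\in D}V_\alpha$ carry the induced scalar product $\langle\cdot,\cdot\rangle$ and corresponding norm $\|\cdot\|$, and let $\mathbf V_{\|\cdot\|}$ be its completion. Let $A$ be a densely defined linear operator in $\mathbf V_{\|\cdot\|}$, with domain $\mathcal D(A)$, generating a flow on $\mathcal D(A)$. Let $I=(0,T)$ with $T>0$ and $\mathbf v_0=\lambda_0\bigotimes_{\alpha\in D}v_0^{(\alpha)}\in\mathfrak M_{(1,\dots,1)}(\mathbf V)$ with $\|v_0^{(\alpha)}\|_\alpha=1$. Let $\mathbf v_r(t)=\lambda(t)\bigotimes_{\alpha\in D}v_\alpha(t)\in\mathfrak M_{(1,\dots,1)}(\mathbf V)$, with $\lambda(0)=\lambda_0$, $(v_1(t),\dots,v_d(t))\in\prod_{\alpha\in D}\mathbb S_{V_\alpha}$, and $\lambda$, $v_\alpha$ of class $\mathcal C^1$, be a solution of $$\dot{\mathbf v}_r(t)=\mathcal P_{\mathbf v_r(t)}(A\mathbf v_r(t))\ \text{ for }t\in I,\qquad\mathbf v_r(0)=\mathbf v_0.$$ Then $$\langle\dot v_\alpha(t),\dot w_\alpha\rangle_\alpha-\mathrm a_\alpha(t;v_\alpha(t),\dot w_\alpha)=0\quad\text{for all }\dot w_\alpha\in\mathbb T_{v_\alpha(t)}(\mathbb S_{V_\alpha}),\ \alpha\in D,$$ and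 $$\lambda(t)=\lambda_0\exp\left(\int_0^t\Big\langle A\Big(\bigotimes_{\alpha\in D}v_\alpha(s)\Big),\bigotimes_{\alpha\in D}v_\alpha(s)\Big\rangle\,ds\right).$$
   Context: The induced scalar product on $\mathbf V$ is the unique bilinear extension of $\langle\bigotimes_\alpha v^{(\alpha)},\bigotimes_\alpha w^{(\alpha)}\rangle=\prod_{\alpha\in D}\langle v^{(\alpha)},w^{(\alpha)}\rangle_\alpha$ (real scalars). $\mathfrak M_{(1,\dots,1)}(\mathbf V)$ (the Hartree manifold) is the set of nonzero elementary tensors $\lambda\bigotimes_{\alpha\in D}v_\alpha$. For $\mathbf v=\lambda\bigotimes_\alpha v_\alpha$ in it, with $W_\alpha=\mathrm{span}\{v_\alpha\}^\perp$, the image of its tangent space in $\mathbf V_{\|\cdot\|}$ is the closed subspace $$\mathbf Z^{(D)}(\mathbf v)=\mathrm{span}\Big\{\bigotimes_\alpha v_\alpha\Big\}\oplus\bigoplus_{\alpha\in D}\Big(W_\alpha\otimes_a\mathrm{span}\Big\{\bigotimes_{\beta\ne\alpha}v_\beta\Big\}\Big),$$ and $\mathcal P_{\mathbf v}$ denotes the metric (orthogonal) projection of $\mathbf V_{\|\cdot\|}$ onto $\mathbf Z^{(D)}(\mathbf v)$. $\mathbb S_{V_\alpha}=\{x\in V_\alpha:\|x\|_\alpha=1\}$ and $\mathbb T_x(\mathbb S_{V_\alpha})=\{x'\in V_\alpha:\langle x,x'\rangle_\alpha=0\}$. For the given curve, $\mathrm a_\alpha(t;z_\alpha,y_\alpha):=\big\langle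 A\big(z_\alpha\otimes\bigotimes_{\beta\ne\alpha}v_\beta(t)\big),\,y_\alpha\otimes\bigotimes_{\beta\ne\alpha}v_\beta(t)\big\rangle$ (for $z_\alpha$ such that $z_\alpha\otimes\bigotimes_{\beta\neq\alpha}v_\beta(t)\in\mathcal D(A)$). Flow: $A$ generates a flow if there are bijections $\boldsymbol\varphi_t:\mathcal D(A)\to\mathcal D(A)$ with $\boldsymbol\varphi_0=\mathrm{id}$, $\boldsymbol\varphi_{t+s}=\boldsymbol\varphi_t\circ\boldsymbol\varphi_s$, and such that for $\mathbf u_0\in\mathcal D(A)$ the curve $\mathbf u(t)=\boldsymbol\varphi_t(\mathbf u_0)$ is differentiable in $\mathbf V_{\|\cdot\|}$ with $\dot{\mathbf u}=A\mathbf u$, $\mathbf u(0)=\mathbf u_0$. The solution satisfies $\mathbf v_r(t)\in\mathcal D(A)$; the $\mathcal C^1$ functions $\lambda,v_\alpha$ are defined up to $t=0$. *)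

theory Defs
  imports "HOL-Analysis.Analysis"
begin

section \<open>Tensor products of Hilbert spaces\<close>

text \<open>
  The Hilbert spaces \<open>V \<alpha>\<close> (\<open>\<alpha> \<in> D\<close>) are complete linear subspaces of one real inner product
  space. Any finite family of Hilbert spaces is of this form up to isometry: take the summands of
  the Hilbert direct sum.

  A family \<open>v\<close> represents an element of the product of the \<open>V \<alpha>\<close> when \<open>v \<in> Pi D V\<close>; its values
  outside \<open>D\<close> are irrelevant, which is why multilinear maps are required to ignore them.
\<close>

definition hilbert_family :: "'i set \<Rightarrow> ('i \<Rightarrow> 'a::real_inner set) \<Rightarrow> bool" where
  "hilbert_family D V \<longleftrightarrow> (\<forall>\<alpha>\<in>D. subspace (V \<alpha>) \<and> complete (V \<alpha>))"

definition multilinear_on ::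
    "'i set \<Rightarrow> ('i \<Rightarrow> 'a::real_vector set) \<Rightarrow> (('i \<Rightarrow> 'a) \<Rightarrow> 'b::real_vector) \<Rightarrow> bool" where
  "multilinear_on D V f \<longleftrightarrow>
     (\<forall>v\<in>Pi D V. \<forall>w\<in>Pi D V. (\<forall>\<alpha>\<in>D. v \<alpha> = w \<alpha>) \<longrightarrow> f v = f w) \<and>
     (\<forall>v\<in>Pi D V. \<forall>\<alpha>\<in>D. \<forall>x\<in>V \<alpha>. \<forall>y\<in>V \<alpha>.
        f (v(\<alpha> := x + y)) = f (v(\<alpha> := x)) + f (v(\<alpha> := y))) \<and>
     (\<forall>v\<in>Pi D V. \<forall>\<alpha>\<in>D. \<forall>c. \<forall>x\<in>V \<alpha>. f (v(\<alpha> := c *\<^sub>R x)) = c *\<^sub>R f (v(\<alpha> := x)))"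

text \<open>
  \<open>\<tau> v\<close> is the elementary tensor of the family \<open>v\<close>; the algebraic tensor product is the linear span
  of the elementary tensors. In its universal property it suffices to let the multilinear
  maps take real values: linear functionals separate the points of a vector space, so this already
  forces the canonical map from the tensor product onto the span to be injective. Uniqueness of the
  factorization on the span is automatic.
\<close>

definition algebraic_tensors ::
    "'i set \<Rightarrow> ('i \<Rightarrow> 'a::real_vector set) \<Rightarrow> (('i \<Rightarrow> 'a) \<Rightarrow> 'h::real_vector) \<Rightarrow> 'h set" where
  "algebraic_tensors D V \<tau> = span (\<tau> ` Pi D V)"

definition is_algebraic_tensor_product ::
    "'i set \<Rightarrow> ('i \<Rightarrow> 'a::real_vector set) \<Rightarrow> (('i \<Rightarrow> 'a) \<Rightarrow> 'h::real_vector) \<Rightarrow> bool" where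
  "is_algebraic_tensor_product D V \<tau> \<longleftrightarrow>
     multilinear_on D V \<tau> \<and>
     (\<forall>f :: ('i \<Rightarrow> 'a) \<Rightarrow> real. multilinear_on D V f \<longrightarrow>
        (\<exists>g. linear g \<and> (\<forall>v\<in>Pi D V. f v = g (\<tau> v))))"

text \<open>
  The complete space \<open>'h\<close> is the completion of the algebraic tensor product with respect to the
  induced scalar product: it contains it densely, and its inner product restricts to the induced one.
\<close>

definition is_hilbert_tensor_product ::
    "'i set \<Rightarrow> ('i \<Rightarrow> 'a::real_inner set) \<Rightarrow>
     (('i \<Rightarrow> 'a) \<Rightarrow> 'h::{real_inner, complete_space}) \<Rightarrow> bool" where
  "is_hilbert_tensor_product D V \<tau> \<longleftrightarrow>
     is_algebraic_tensor_product D V \<tau> \<and>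
     (\<forall>v\<in>Pi D V. \<forall>w\<in>Pi D V. \<tau> v \<bullet> \<tau> w = (\<Prod>\<alpha>\<in>D. v \<alpha> \<bullet> w \<alpha>)) \<and>
     closure (algebraic_tensors D V \<tau>) = UNIV"


section \<open>The Hartree manifold\<close>

definition hartree_manifold ::
    "'i set \<Rightarrow> ('i \<Rightarrow> 'a::real_vector set) \<Rightarrow> (('i \<Rightarrow> 'a) \<Rightarrow> 'h::real_vector) \<Rightarrow> 'h set" where
  "hartree_manifold D V \<tau> = {c *\<^sub>R \<tau> v | c v. v \<in> Pi D V \<and> c *\<^sub>R \<tau> v \<noteq> 0}"

text \<open>
  The space \<open>hartree_tangent D V \<tau> v\<close> is attached to the tensor \<open>c *\<^sub>R \<tau> v\<close>, for any \<open>c \<noteq> 0\<close>; it does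
  not change when the vectors \<open>v \<alpha>\<close> are rescaled by nonzero factors.
  The elementary tensor of \<open>w\<close> in position \<open>\<alpha>\<close> and \<open>v \<beta>\<close> in the positions \<open>\<beta> \<noteq> \<alpha>\<close> is
  \<open>\<tau> (v(\<alpha> := w))\<close>. The summands are pairwise orthogonal, so that the sum is direct.
\<close>

definition hartree_complement :: "('i \<Rightarrow> 'a::real_inner set) \<Rightarrow> ('i \<Rightarrow> 'a) \<Rightarrow> 'i \<Rightarrow> 'a set" where
  "hartree_complement V v \<alpha> = V \<alpha> \<inter> (span {v \<alpha>})\<^sup>\<bottom>"

definition hartree_tangent ::
    "'i set \<Rightarrow> ('i \<Rightarrow> 'a::real_inner set) \<Rightarrow> (('i \<Rightarrow> 'a) \<Rightarrow> 'h::real_vector) \<Rightarrow>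
     ('i \<Rightarrow> 'a) \<Rightarrow> 'h set" where
  "hartree_tangent D V \<tau> v =
     {z0 + (\<Sum>\<alpha>\<in>D. z \<alpha>) | z0 z. z0 \<in> span {\<tau> v} \<and>
        (\<forall>\<alpha>\<in>D. z \<alpha> \<in> span {\<tau> (v(\<alpha> := w)) | w. w \<in> hartree_complement V v \<alpha>})}"

text \<open>The library's \<open>closest_point\<close> is restricted to locally compact spaces.\<close>

definition metric_projection :: "'h::metric_space set \<Rightarrow> 'h \<Rightarrow> 'h" where
  "metric_projection Z x = (THE z. z \<in> Z \<and> (\<forall>y\<in>Z. dist x z \<le> dist x y))"

definition unit_sphere_in :: "'a::real_inner set \<Rightarrow> 'a set" where
  "unit_sphere_in X = {x \<in> X. norm x = 1}"

definition sphere_tangent_in :: "'a::real_inner set \<Rightarrow> 'a \<Rightarrow> 'a set" where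
  "sphere_tangent_in X x = {x' \<in> X. x \<bullet> x' = 0}"


section \<open>Unbounded operators and flows\<close>

definition densely_defined_linear_operator ::
    "'h::real_normed_vector set \<Rightarrow> ('h \<Rightarrow> 'h) \<Rightarrow> bool" where
  "densely_defined_linear_operator DA A \<longleftrightarrow>
     subspace DA \<and> closure DA = UNIV \<and>
     (\<forall>x\<in>DA. \<forall>y\<in>DA. A (x + y) = A x + A y) \<and>
     (\<forall>c. \<forall>x\<in>DA. A (c *\<^sub>R x) = c *\<^sub>R A x)"

definition generates_flow :: "'h::real_normed_vector set \<Rightarrow> ('h \<Rightarrow> 'h) \<Rightarrow> bool" where
  "generates_flow DA A \<longleftrightarrow>
     (\<exists>\<phi> :: real \<Rightarrow> 'h \<Rightarrow> 'h.
        (\<forall>t. bij_betw (\<phi> t) DA DA) \<and>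
        (\<forall>u\<in>DA. \<phi> 0 u = u) \<and>
        (\<forall>t s. \<forall>u\<in>DA. \<phi> (t + s) u = \<phi> t (\<phi> s u)) \<and>
        (\<forall>u\<in>DA. \<forall>t. ((\<lambda>t. \<phi> t u) has_vector_derivative A (\<phi> t u)) (at t)))"

text \<open>
  Unlike the library's \<open>C1_differentiable_on\<close>, this uses one-sided derivatives at boundary points
  of \<open>S\<close> that belong to \<open>S\<close>.
\<close>

definition C1_within :: "real set \<Rightarrow> (real \<Rightarrow> 'b::real_normed_vector) \<Rightarrow> bool" where
  "C1_within S f \<longleftrightarrow>
     (\<exists>f'. (\<forall>t\<in>S. (f has_vector_derivative f' t) (at t within S)) \<and> continuous_on S f')"

text \<open>
  The form \<open>a\<^sub>\<alpha>(t; z, y)\<close> of the curve \<open>v\<close> is \<open>hartree_form A \<tau> (v t) \<alpha> z y\<close>.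
\<close>

definition hartree_form ::
    "('h \<Rightarrow> 'h::real_inner) \<Rightarrow> (('i \<Rightarrow> 'a) \<Rightarrow> 'h) \<Rightarrow> ('i \<Rightarrow> 'a) \<Rightarrow> 'i \<Rightarrow> 'a \<Rightarrow> 'a \<Rightarrow> real" where
  "hartree_form A \<tau> v \<alpha> z y = A (\<tau> (v(\<alpha> := z))) \<bullet> \<tau> (v(\<alpha> := y))"

end

theory Submission
  imports Defs
begin

text \<open>
  Since \<open>A v\<^sub>r - P (A v\<^sub>r)\<close> is orthogonal to the tangent space, the equation of motion may be
  tested with any tangent vector. Testing with \<open>\<tau> (v(\<alpha> := w))\<close> for \<open>w\<close> orthogonal to \<open>v \<alpha>\<close>
  isolates \<open>v \<alpha>\<close>, because a curve on the unit sphere is orthogonal to its derivative;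
  testing with \<open>\<tau> v\<close> isolates the scalar and leaves a linear equation for it. The projection
  exists because the tangent space is a finite orthogonal sum of complete subspaces.
\<close>

section \<open>Projections onto complete subspaces\<close>

text \<open>A minimizing sequence for the squared distance to \<open>x\<close> is Cauchy by the
  parallelogram law. Its limit \<open>z\<close> lies in \<open>S\<close> by completeness and attains
  the infimum, and perturbing \<open>z\<close> along a direction of \<open>S\<close> shows that the
  residual \<open>x - z\<close> has no component there.\<close>

lemma complete_subspace_projection_exists:
  fixes S :: "'a::real_inner set"
  assumes S: "subspace S" and complete: "complete S"
  obtains z where "z \<in> S" "\<And>y. y \<in> S \<Longrightarrow> (x - z) \<bullet> y = 0"
proof -
  let ?N = "(\<lambda>y. (norm (x - y))\<^sup>2) ` S"
  define \<delta> where "\<delta> = Inf ?N"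
  have ne: "?N \<noteq> {}"
    using subspace_0[OF S] by blast
  have bdd: "bdd_below ?N"
    by (rule bdd_belowI[of _ 0]) auto
  have lower: "\<delta> \<le> (norm (x - y))\<^sup>2" if "y \<in> S" for y
    unfolding \<delta>_def using bdd that by (simp add: cInf_lower)
  have "\<exists>y\<in>S. (norm (x - y))\<^sup>2 < \<delta> + 1 / real (Suc n)" for n
  proof -
    have "Inf ?N < \<delta> + 1 / real (Suc n)"
      by (simp add: \<delta>_def)
    then show ?thesis
      using cInf_lessD[OF ne] by fastforce
  qed
  then obtain y where y: "\<And>n. y n \<in> S" "\<And>n. (norm (x - y n))\<^sup>2 < \<delta> + 1 / real (Suc n)"
    by metis
  have close: "(norm (y m - y n))\<^sup>2 \<le> 2 / real (Suc m) + 2 / real (Suc n)" for m n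
  proof -
    \<comment> \<open>The midpoint stays in \<open>S\<close>, so its squared distance to
      \<open>x\<close> is at least \<open>\<delta>\<close>. The parallelogram law turns this into a
      bound on \<open>y m - y n\<close> in which only the two excesses over \<open>\<delta>\<close>
      survive.\<close>
    let ?c = "(1/2) *\<^sub>R (y m + y n)"
    have "?c \<in> S"
      using y(1) S by (intro subspace_scale subspace_add)
    then have "\<delta> \<le> (norm (x - ?c))\<^sup>2"
      by (rule lower)
    moreover have "(norm (y m - y n))\<^sup>2 =
        2 * (norm (x - y m))\<^sup>2 + 2 * (norm (x - y n))\<^sup>2 - 4 * (norm (x - ?c))\<^sup>2"
      by (simp add: power2_norm_eq_inner algebra_simps inner_commute)
    ultimately show ?thesis
      using y(2)[of m] y(2)[of n] by simp
  qed
  have "Cauchy y"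
  proof (rule metric_CauchyI)
    fix e :: real
    assume "0 < e"
    \<comment> \<open>Beyond \<open>M\<close> each of the two terms of \<open>close\<close> is at
      most \<open>2 / real (Suc M)\<close>, so their sum has to be brought below
      \<open>e\<^sup>2\<close>.\<close>
    then obtain M where M: "4 / e\<^sup>2 < real (Suc M)"
      using reals_Archimedean2[of "4 / e\<^sup>2"] by (metis less_Suc_eq of_nat_less_iff order_less_trans)
    have "dist (y m) (y n) < e" if "m \<ge> M" "n \<ge> M" for m n
    proof -
      have "2 / real (Suc m) \<le> 2 / real (Suc M)" "2 / real (Suc n) \<le> 2 / real (Suc M)"
        using that by (auto intro!: divide_left_mono)
      then have "(norm (y m - y n))\<^sup>2 \<le> 4 / real (Suc M)"
        using close[of m n] by simp
      also have "\<dots> < e\<^sup>2"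
        using M \<open>0 < e\<close> by (simp add: field_simps)
      finally show ?thesis
        using \<open>0 < e\<close> by (simp add: dist_norm power2_less_imp_less)
    qed
    then show "\<exists>M. \<forall>m\<ge>M. \<forall>n\<ge>M. dist (y m) (y n) < e"
      by blast
  qed
  then obtain z where z: "z \<in> S" "y \<longlonglongrightarrow> z"
    using completeE[OF complete, of y] y(1) by blast
  have min: "(norm (x - z))\<^sup>2 \<le> \<delta>"
  proof (rule LIMSEQ_le)
    show "(\<lambda>n. (norm (x - y n))\<^sup>2) \<longlonglongrightarrow> (norm (x - z))\<^sup>2"
      by (intro tendsto_intros z)
    show "(\<lambda>n. \<delta> + 1 / real (Suc n)) \<longlonglongrightarrow> \<delta>"
      using tendsto_add[OF tendsto_const LIMSEQ_inverse_real_of_nat]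
      by (simp add: inverse_eq_divide)
    show "\<exists>N. \<forall>n\<ge>N. (norm (x - y n))\<^sup>2 \<le> \<delta> + 1 / real (Suc n)"
      using y(2) less_imp_le by blast
  qed
  have "(x - z) \<bullet> u = 0" if u: "u \<in> S" for u
  proof (cases "u = 0")
    case False
    \<comment> \<open>This \<open>c\<close> minimizes the norm of
      \<open>(x - z) - c *\<^sub>R u\<close>. The squared norm drops by
      \<open>((x - z) \<bullet> u)\<^sup>2 / (u \<bullet> u)\<close>, and minimality of
      \<open>z\<close> forces that drop to be at most zero.\<close>
    define c where "c = ((x - z) \<bullet> u) / (u \<bullet> u)"
    have "z + c *\<^sub>R u \<in> S"
      using z u S by (intro subspace_scale subspace_add)
    then have "(norm (x - z))\<^sup>2 \<le> (norm ((x - z) - c *\<^sub>R u))\<^sup>2"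
      using order_trans[OF min lower[of "z + c *\<^sub>R u"]] by (simp add: diff_diff_eq)
    also have "\<dots> = (norm (x - z))\<^sup>2 - 2 * (c * ((x - z) \<bullet> u)) + c * (c * (u \<bullet> u))"
      by (simp only: power2_norm_eq_inner inner_diff_left inner_diff_right inner_scaleR_left
          inner_scaleR_right) (simp add: algebra_simps inner_commute)
    also have "c * (u \<bullet> u) = (x - z) \<bullet> u"
      using False by (simp add: c_def)
    finally have "((x - z) \<bullet> u)\<^sup>2 / (u \<bullet> u) \<le> 0"
      by (simp add: c_def power2_eq_square)
    moreover have "0 < u \<bullet> u"
      using False by simp
    ultimately show ?thesis
      by (simp add: divide_le_0_iff)
  qed simp
  with z(1) show thesis
    using that by blast
qed

text \<open>By Pythagoras a point \<open>y\<close> of \<open>Z\<close> is farther from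
  \<open>x\<close> than \<open>p\<close> by exactly the term \<open>(dist p y)\<^sup>2\<close> in
  squared distance. Hence \<open>p\<close> is the unique minimizer, which is what the definite
  description in \<open>metric_projection\<close> requires.\<close>

lemma metric_projection_eqI:
  fixes x :: "'h::real_inner"
  assumes p: "p \<in> Z" and orth: "\<And>y. y \<in> Z \<Longrightarrow> (x - p) \<bullet> y = 0"
  shows "metric_projection Z x = p"
proof -
  have pyth: "(dist x y)\<^sup>2 = (dist x p)\<^sup>2 + (dist p y)\<^sup>2" if "y \<in> Z" for y
  proof -
    have "(x - p) \<bullet> (p - y) = 0"
      using orth[OF p] orth[OF that] by (simp add: inner_diff_right)
    moreover have "x - y = (x - p) + (p - y)"
      by simp
    ultimately show ?thesis
      unfolding dist_norm using norm_add_Pythagorean[of "x - p" "p - y"]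
      by (simp add: orthogonal_def)
  qed
  show ?thesis
    unfolding metric_projection_def
  proof (rule the_equality)
    have "dist x p \<le> dist x y" if "y \<in> Z" for y
      by (rule power2_le_imp_le) (simp_all add: pyth[OF that])
    with p show "p \<in> Z \<and> (\<forall>y\<in>Z. dist x p \<le> dist x y)"
      by blast
  next
    fix z
    assume z: "z \<in> Z \<and> (\<forall>y\<in>Z. dist x z \<le> dist x y)"
    with p have "(dist x z)\<^sup>2 \<le> (dist x p)\<^sup>2"
      by (simp add: power_mono)
    with pyth[of z] z show "z = p"
      by simp
  qed
qed

text \<open>A Cauchy sequence in the image pulls back to a Cauchy sequence in \<open>S\<close>, and
  its limit is carried forward again. This transports completeness from a complement
  \<open>W\<close> in \<open>V \<alpha>\<close> to the corresponding summand of the tangent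
  space.\<close>

lemma complete_image_isometry:
  assumes complete: "complete S"
    and isometry: "\<And>x y. x \<in> S \<Longrightarrow> y \<in> S \<Longrightarrow> dist (f x) (f y) = dist x y"
  shows "complete (f ` S)"
proof (rule completeI)
  fix g :: "nat \<Rightarrow> 'b"
  assume "\<forall>n. g n \<in> f ` S" and Cauchy: "Cauchy g"
  then have "\<forall>n. \<exists>x\<in>S. g n = f x"
    by blast
  then obtain h where h: "\<And>n. h n \<in> S" "\<And>n. g n = f (h n)"
    by metis
  have "Cauchy h"
    using Cauchy h isometry by (simp add: Cauchy_def)
  then obtain l where l: "l \<in> S" "h \<longlonglongrightarrow> l"
    using completeE[OF complete, of h] h(1) by blast
  have "(\<lambda>n. dist (g n) (f l)) \<longlonglongrightarrow> 0"
    using l h isometry by (simp add: tendsto_dist_iff[of h])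
  then have "g \<longlonglongrightarrow> f l"
    by (simp add: tendsto_dist_iff[of g])
  with l show "\<exists>l\<in>f ` S. g \<longlonglongrightarrow> l"
    by blast
qed

section \<open>Geometry of the Hartree tangent space\<close>

lemma hartree_complement_alt:
  "hartree_complement V v \<alpha> = {w \<in> V \<alpha>. v \<alpha> \<bullet> w = 0}"
proof -
  have "x \<in> (span {v \<alpha>})\<^sup>\<bottom> \<longleftrightarrow> v \<alpha> \<bullet> x = 0" for x
    by (auto simp: orthogonal_comp_def orthogonal_def span_singleton inner_commute)
  then show ?thesis
    by (auto simp: hartree_complement_def)
qed

lemma hartree_complement_complete:
  assumes "hilbert_family D V" "\<alpha> \<in> D"
  shows "subspace (hartree_complement V v \<alpha>)" "complete (hartree_complement V v \<alpha>)"
proof -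
  have V: "subspace (V \<alpha>)" "complete (V \<alpha>)"
    using assms by (auto simp: hilbert_family_def)
  have eq: "hartree_complement V v \<alpha> = V \<alpha> \<inter> {w. v \<alpha> \<bullet> w = 0}"
    by (auto simp: hartree_complement_alt)
  show "subspace (hartree_complement V v \<alpha>)"
    unfolding eq by (intro subspace_inter V subspace_hyperplane)
  show "complete (hartree_complement V v \<alpha>)"
    unfolding eq by (intro complete_Int_closed V closed_hyperplane)
qed

lemma hilbert_tensor_product_inner:
  assumes "is_hilbert_tensor_product D V \<tau>" "v \<in> Pi D V" "w \<in> Pi D V"
  shows "\<tau> v \<bullet> \<tau> w = (\<Prod>\<alpha>\<in>D. v \<alpha> \<bullet> w \<alpha>)"
  using assms by (simp add: is_hilbert_tensor_product_def)

context
  fixes D :: "'i set" and V :: "'i \<Rightarrow> 'a::real_inner set"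
    and \<tau> :: "('i \<Rightarrow> 'a) \<Rightarrow> 'h::{real_inner, complete_space}" and v :: "'i \<Rightarrow> 'a"
  assumes fin: "finite D" and V: "hilbert_family D V"
    and tensor: "is_hilbert_tensor_product D V \<tau>"
    and v: "\<forall>\<alpha>\<in>D. v \<alpha> \<in> unit_sphere_in (V \<alpha>)"
begin

lemma unit_family_in_Pi: "v \<in> Pi D V"
  using v by (auto simp: unit_sphere_in_def)

lemma unit_family_inner_self: "\<alpha> \<in> D \<Longrightarrow> v \<alpha> \<bullet> v \<alpha> = 1"
  using v by (auto simp: unit_sphere_in_def dot_square_norm)

lemma fun_upd_in_Pi: "w \<in> V \<alpha> \<Longrightarrow> v(\<alpha> := w) \<in> Pi D V"
  using unit_family_in_Pi by auto

text \<open>Every position other than \<open>\<alpha>\<close> holds the same unit vector on both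
  sides and contributes the factor 1. So replacing the entry at \<open>\<alpha>\<close> embeds
  \<open>V \<alpha>\<close> isometrically into the tensor space.\<close>

lemma elementary_tensor_inner_same:
  assumes "\<alpha> \<in> D" "w \<in> V \<alpha>" "w' \<in> V \<alpha>"
  shows "\<tau> (v(\<alpha> := w)) \<bullet> \<tau> (v(\<alpha> := w')) = w \<bullet> w'"
proof -
  have "(\<Prod>\<beta>\<in>D - {\<alpha>}. (v(\<alpha> := w)) \<beta> \<bullet> (v(\<alpha> := w')) \<beta>) = 1"
    by (rule prod.neutral) (simp add: unit_family_inner_self)
  then show ?thesis
    using assms fin
    by (simp add: hilbert_tensor_product_inner[OF tensor] fun_upd_in_Pi prod.remove[of D \<alpha>])
qed

text \<open>At position \<open>\<alpha>\<close> the second tensor still carries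
  \<open>v \<alpha>\<close>, to which \<open>w\<close> is orthogonal, so one factor of the product
  vanishes. This makes the summands of the tangent space pairwise orthogonal.\<close>

lemma elementary_tensor_inner_different:
  assumes "\<alpha> \<in> D" "\<alpha> \<noteq> \<beta>" "w \<in> hartree_complement V v \<alpha>" "w' \<in> V \<beta>"
  shows "\<tau> (v(\<alpha> := w)) \<bullet> \<tau> (v(\<beta> := w')) = 0"
  using assms fin
  by (simp add: hilbert_tensor_product_inner[OF tensor] fun_upd_in_Pi hartree_complement_alt
      prod.remove[of D \<alpha>] inner_commute)

lemma elementary_tensor_inner_base:
  assumes "\<alpha> \<in> D" "w \<in> hartree_complement V v \<alpha>"
  shows "\<tau> v \<bullet> \<tau> (v(\<alpha> := w)) = 0"
  using elementary_tensor_inner_same[of \<alpha> "v \<alpha>" w] assms unit_family_in_Pi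
  by (auto simp: hartree_complement_alt)

text \<open>The map sending \<open>w\<close> to \<open>\<tau> (v(\<alpha> := w))\<close> is linear
  and isometric on the complement. Its image is therefore already a subspace, so that taking the
  span adds nothing, and it inherits completeness.\<close>

lemma hartree_summand_complete:
  assumes "\<alpha> \<in> D"
  defines "S \<equiv> (\<lambda>w. \<tau> (v(\<alpha> := w))) ` hartree_complement V v \<alpha>"
  shows "subspace S" "complete S"
    "span {\<tau> (v(\<alpha> := w)) | w. w \<in> hartree_complement V v \<alpha>} = S"
proof -
  let ?W = "hartree_complement V v \<alpha>"
  have W: "subspace ?W" "complete ?W"
    using hartree_complement_complete[OF V assms(1)] by auto
  have WV: "?W \<subseteq> V \<alpha>"
    by (auto simp: hartree_complement_alt)
  have "multilinear_on D V \<tau>"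
    using tensor by (simp add: is_hilbert_tensor_product_def is_algebraic_tensor_product_def)
  then have add: "\<tau> (v(\<alpha> := x + y)) = \<tau> (v(\<alpha> := x)) + \<tau> (v(\<alpha> := y))"
    and scale: "\<tau> (v(\<alpha> := c *\<^sub>R x)) = c *\<^sub>R \<tau> (v(\<alpha> := x))"
    if "x \<in> ?W" "y \<in> ?W" for x y c
    using that WV assms(1) unit_family_in_Pi unfolding multilinear_on_def by blast+
  show sub: "subspace S"
  proof (rule subspaceI)
    \<comment> \<open>Homogeneity with coefficient 0 gives
      \<open>\<tau> (v(\<alpha> := 0)) = 0\<close>, which exhibits the zero vector as an element of
      the image.\<close>
    show "0 \<in> S"
      using scale[of 0 0 0] subspace_0[OF W(1)] by (force simp: S_def)
    fix x y
    assume "x \<in> S" "y \<in> S"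
    then show "x + y \<in> S"
      using subspace_add[OF W(1)] by (auto simp: S_def add[symmetric])
  next
    fix c x
    assume "x \<in> S"
    then show "c *\<^sub>R x \<in> S"
      using subspace_scale[OF W(1)] by (auto simp: S_def scale[symmetric])
  qed
  show "complete S"
    unfolding S_def
  proof (rule complete_image_isometry[OF W(2)])
    fix x y
    assume xy: "x \<in> ?W" "y \<in> ?W"
    have "(dist (\<tau> (v(\<alpha> := x))) (\<tau> (v(\<alpha> := y))))\<^sup>2 = (dist x y)\<^sup>2"
      using xy WV assms(1)
      by (simp add: dist_norm power2_norm_eq_inner inner_diff_left inner_diff_right
          elementary_tensor_inner_same subset_iff)
    then show "dist (\<tau> (v(\<alpha> := x))) (\<tau> (v(\<alpha> := y))) = dist x y"
      by simp
  qed
  have "{\<tau> (v(\<alpha> := w)) | w. w \<in> ?W} = S"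
    by (auto simp: S_def)
  then show "span {\<tau> (v(\<alpha> := w)) | w. w \<in> ?W} = S"
    using sub by (simp add: span_eq_iff)
qed

text \<open>Since the summands are mutually orthogonal, the sum of the projections onto them is the
  projection onto the whole tangent space. Exhibiting this point shows that the definite description
  denotes and that the residual is orthogonal.\<close>

lemma hartree_tangent_projection:
  assumes y: "y \<in> hartree_tangent D V \<tau> v"
  shows "(x - metric_projection (hartree_tangent D V \<tau> v) x) \<bullet> y = 0"
proof -
  let ?S = "\<lambda>\<alpha>. (\<lambda>w. \<tau> (v(\<alpha> := w))) ` hartree_complement V v \<alpha>"
  have "\<forall>\<alpha>\<in>D. \<exists>z\<in>?S \<alpha>. \<forall>y\<in>?S \<alpha>. (x - z) \<bullet> y = 0"
    by (metis complete_subspace_projection_exists hartree_summand_complete(1,2))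
  then obtain z where z: "\<And>\<alpha>. \<alpha> \<in> D \<Longrightarrow> z \<alpha> \<in> ?S \<alpha>"
    and orth: "\<And>\<alpha> y. \<alpha> \<in> D \<Longrightarrow> y \<in> ?S \<alpha> \<Longrightarrow> (x - z \<alpha>) \<bullet> y = 0"
    by metis
  \<comment> \<open>As \<open>\<tau> v\<close> has norm 1, its coefficient in the projection onto
    its line is just the inner product with \<open>x\<close>; \<open>z \<alpha>\<close> is the
    projection onto the summand belonging to \<open>\<alpha>\<close>.\<close>
  define p where "p = (x \<bullet> \<tau> v) *\<^sub>R \<tau> v + (\<Sum>\<alpha>\<in>D. z \<alpha>)"
  have tangent: "hartree_tangent D V \<tau> v =
      {z0 + (\<Sum>\<alpha>\<in>D. z \<alpha>) | z0 z. z0 \<in> span {\<tau> v} \<and> (\<forall>\<alpha>\<in>D. z \<alpha> \<in> ?S \<alpha>)}"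
    using hartree_summand_complete(3) unfolding hartree_tangent_def by simp
  have pZ: "p \<in> hartree_tangent D V \<tau> v"
    unfolding tangent p_def using z by (auto intro: span_base span_scale)
  have base: "\<tau> v \<bullet> \<tau> v = 1"
    using hilbert_tensor_product_inner[OF tensor unit_family_in_Pi unit_family_in_Pi]
    by (simp add: unit_family_inner_self)
  have z_base: "z \<alpha> \<bullet> \<tau> v = 0" if "\<alpha> \<in> D" for \<alpha>
    using z[OF that] elementary_tensor_inner_base[OF that] by (auto simp: inner_commute)
  have orth_base: "(x - p) \<bullet> \<tau> v = 0"
    using base z_base by (simp add: p_def inner_diff_left inner_add_left inner_sum_left)
  have orth_summand: "(x - p) \<bullet> s = 0" if \<alpha>: "\<alpha> \<in> D" and s: "s \<in> ?S \<alpha>" for \<alpha> s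
  proof -
    have "\<tau> v \<bullet> s = 0"
      using s elementary_tensor_inner_base[OF \<alpha>] by auto
    \<comment> \<open>Against a vector of one summand only the component \<open>z \<alpha>\<close>
      of \<open>p\<close> survives, so orthogonality of \<open>x - p\<close> reduces to that of
      \<open>x - z \<alpha>\<close>.\<close>
    moreover have "z \<beta> \<bullet> s = 0" if "\<beta> \<in> D - {\<alpha>}" for \<beta>
      using that z[of \<beta>] s elementary_tensor_inner_different[of \<beta> \<alpha>]
      by (auto simp: hartree_complement_alt)
    then have "(\<Sum>\<beta>\<in>D. z \<beta> \<bullet> s) = z \<alpha> \<bullet> s"
      using \<alpha> fin by (simp add: sum.remove[of D \<alpha>])
    ultimately show ?thesis
      using orth[OF \<alpha> s] by (simp add: p_def inner_diff_left inner_add_left inner_sum_left)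
  qed
  have orth_p: "(x - p) \<bullet> y = 0" if "y \<in> hartree_tangent D V \<tau> v" for y
    using that orth_base orth_summand unfolding tangent
    by (auto simp: inner_add_right inner_sum_right span_singleton)
  have "metric_projection (hartree_tangent D V \<tau> v) x = p"
    by (rule metric_projection_eqI[OF pZ orth_p])
  with orth_p[OF y] show ?thesis
    by simp
qed

lemma base_in_hartree_tangent: "\<tau> v \<in> hartree_tangent D V \<tau> v"
  unfolding hartree_tangent_def
  by (rule CollectI, rule exI[of _ "\<tau> v"], rule exI[of _ "\<lambda>_. 0"])
    (simp add: span_base span_zero)

lemma variation_in_hartree_tangent:
  assumes "\<alpha> \<in> D" "w \<in> hartree_complement V v \<alpha>"
  shows "\<tau> (v(\<alpha> := w)) \<in> hartree_tangent D V \<tau> v"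
proof -
  let ?z = "\<lambda>\<beta>. if \<beta> = \<alpha> then \<tau> (v(\<alpha> := w)) else 0"
  have "\<tau> (v(\<alpha> := w)) = 0 + (\<Sum>\<beta>\<in>D. ?z \<beta>)"
    using assms fin by simp
  moreover have "\<forall>\<beta>\<in>D. ?z \<beta> \<in> span {\<tau> (v(\<beta> := w)) | w. w \<in> hartree_complement V v \<beta>}"
    using assms by (auto intro: span_base span_zero)
  ultimately show ?thesis
    unfolding hartree_tangent_def using span_zero by blast
qed

end

section \<open>Derivatives along curves\<close>

text \<open>One function \<open>f'\<close> serves both as the one-sided derivative at boundary
  points in \<open>S\<close> and as the two-sided derivative in the interior. The former reaches the
  initial time, the latter matches the equation of motion.\<close>

lemma C1_within_obtain:
  assumes "C1_within S f"
  obtains f' where "\<And>t. t \<in> S \<Longrightarrow> (f has_vector_derivative f' t) (at t within S)"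
    "\<And>t. t \<in> interior S \<Longrightarrow> (f has_vector_derivative f' t) (at t)" "continuous_on S f'"
proof -
  obtain f' where f': "\<And>t. t \<in> S \<Longrightarrow> (f has_vector_derivative f' t) (at t within S)"
    "continuous_on S f'"
    using assms by (auto simp: C1_within_def)
  moreover have "(f has_vector_derivative f' t) (at t)" if "t \<in> interior S" for t
    using f'(1)[of t] that interior_subset at_within_interior[OF that] by (metis subsetD)
  ultimately show thesis
    using that by blast
qed

text \<open>The function \<open>f s \<bullet> f s\<close> is constantly 1 near \<open>t\<close>, and
  its derivative is twice the inner product of \<open>f'\<close> and \<open>f t\<close>.\<close>

lemma unit_curve_derivative_orthogonal:
  fixes f :: "real \<Rightarrow> 'a::real_inner"
  assumes I: "open I" "t \<in> I" and unit: "\<forall>s\<in>I. norm (f s) = 1"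
    and f': "(f has_vector_derivative f') (at t)"
  shows "f' \<bullet> f t = 0"
proof -
  note d = f'[unfolded has_vector_derivative_def]
  have "((\<lambda>s. f s \<bullet> f s) has_derivative (\<lambda>h. f t \<bullet> (h *\<^sub>R f') + (h *\<^sub>R f') \<bullet> f t)) (at t)"
    by (rule has_derivative_inner[OF d d])
  then have "((\<lambda>s. 1) has_derivative (\<lambda>h. f t \<bullet> (h *\<^sub>R f') + (h *\<^sub>R f') \<bullet> f t)) (at t)"
    by (rule has_derivative_transform_within_open[OF _ I]) (simp add: unit dot_square_norm)
  then have "(\<lambda>h. f t \<bullet> (h *\<^sub>R f') + (h *\<^sub>R f') \<bullet> f t) = (\<lambda>h. 0)"
    by (rule has_derivative_unique) simp
  from fun_cong[OF this, of 1] show ?thesis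
    by (simp add: inner_commute)
qed

text \<open>
  The other factors contribute nothing because \<open>v' \<beta>\<close> is orthogonal to \<open>v t \<beta>\<close>.
\<close>

lemma hartree_curve_derivative_inner:
  fixes V :: "'i \<Rightarrow> 'a::real_inner set"
    and \<tau> :: "('i \<Rightarrow> 'a) \<Rightarrow> 'h::{real_inner, complete_space}"
  assumes fin: "finite D" and tensor: "is_hilbert_tensor_product D V \<tau>"
    and I: "open I" "t \<in> I"
    and sphere: "\<forall>s\<in>I. \<forall>\<alpha>\<in>D. v s \<alpha> \<in> unit_sphere_in (V \<alpha>)"
    and u: "\<forall>s\<in>I. u s = lam s *\<^sub>R \<tau> (v s)"
    and lam': "(lam has_vector_derivative lam') (at t)"
    and v': "\<And>\<beta>. \<beta> \<in> D \<Longrightarrow> ((\<lambda>s. v s \<beta>) has_vector_derivative v' \<beta>) (at t)"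
    and u': "(u has_vector_derivative u') (at t)"
    and \<alpha>: "\<alpha> \<in> D" and w: "w \<in> V \<alpha>"
  shows "u' \<bullet> \<tau> ((v t)(\<alpha> := w)) = lam' * (v t \<alpha> \<bullet> w) + lam t * (v' \<alpha> \<bullet> w)"
proof -
  \<comment> \<open>The test family is frozen at time \<open>t\<close>. Pairing with its tensor
    turns the curve into \<open>lam\<close> times a finite product of real functions, to which the
    scalar product rule applies.\<close>
  let ?y = "(v t)(\<alpha> := w)"
  let ?f = "\<lambda>\<beta> s. v s \<beta> \<bullet> ?y \<beta>"
  have self: "v s \<beta> \<bullet> v s \<beta> = 1" if "s \<in> I" "\<beta> \<in> D" for s \<beta>
    using that sphere by (auto simp: unit_sphere_in_def dot_square_norm)
  have Pi: "v s \<in> Pi D V" if "s \<in> I" for s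
    using that sphere by (auto simp: unit_sphere_in_def)
  have yPi: "?y \<in> Pi D V"
    using Pi[OF I(2)] w by auto
  have orth: "v' \<beta> \<bullet> v t \<beta> = 0" if "\<beta> \<in> D" for \<beta>
  proof -
    have "\<forall>s\<in>I. norm (v s \<beta>) = 1"
      using that sphere by (auto simp: unit_sphere_in_def)
    then show ?thesis
      using unit_curve_derivative_orthogonal[OF I _ v'[OF that]] by blast
  qed
  have rest: "(\<Prod>\<gamma>\<in>D - {\<alpha>}. ?f \<gamma> t) = 1"
    by (rule prod.neutral) (simp add: self I)
  have "(?f \<beta> has_derivative (\<lambda>h. h *\<^sub>R v' \<beta> \<bullet> ?y \<beta>)) (at t)" if "\<beta> \<in> D" for \<beta>
    using v'[OF that] unfolding has_vector_derivative_def by (rule has_derivative_inner_left)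
  then have "((\<lambda>s. \<Prod>\<beta>\<in>D. ?f \<beta> s) has_derivative
      (\<lambda>h. \<Sum>\<beta>\<in>D. (h *\<^sub>R v' \<beta> \<bullet> ?y \<beta>) * (\<Prod>\<gamma>\<in>D - {\<beta>}. ?f \<gamma> t))) (at t)"
    by (rule has_derivative_prod)
  moreover have "(\<Sum>\<beta>\<in>D. (h *\<^sub>R v' \<beta> \<bullet> ?y \<beta>) * (\<Prod>\<gamma>\<in>D - {\<beta>}. ?f \<gamma> t)) = h * (v' \<alpha> \<bullet> w)" for h
  proof -
    have "(\<Sum>\<beta>\<in>D - {\<alpha>}. (h *\<^sub>R v' \<beta> \<bullet> ?y \<beta>) * (\<Prod>\<gamma>\<in>D - {\<beta>}. ?f \<gamma> t)) = 0"
      by (rule sum.neutral) (simp add: orth)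
    with rest show ?thesis
      using \<alpha> fin by (simp add: sum.remove[of D \<alpha>])
  qed
  ultimately have "((\<lambda>s. \<Prod>\<beta>\<in>D. ?f \<beta> s) has_derivative (\<lambda>h. h * (v' \<alpha> \<bullet> w))) (at t)"
    by (simp only:)
  then have "((\<lambda>s. \<Prod>\<beta>\<in>D. ?f \<beta> s) has_real_derivative v' \<alpha> \<bullet> w) (at t)"
    by (rule has_derivative_imp_has_field_derivative) simp
  moreover have "(lam has_real_derivative lam') (at t)"
    using lam' by (simp add: has_real_derivative_iff_has_vector_derivative)
  moreover have "(\<Prod>\<beta>\<in>D. ?f \<beta> t) = v t \<alpha> \<bullet> w"
    using \<alpha> fin rest by (simp add: prod.remove[of D \<alpha>])
  ultimately have "((\<lambda>s. lam s * (\<Prod>\<beta>\<in>D. ?f \<beta> s)) has_real_derivative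
      lam' * (v t \<alpha> \<bullet> w) + lam t * (v' \<alpha> \<bullet> w)) (at t)"
    using DERIV_mult by (fastforce simp: algebra_simps)
  then have "((\<lambda>s. u s \<bullet> \<tau> ?y) has_real_derivative
      lam' * (v t \<alpha> \<bullet> w) + lam t * (v' \<alpha> \<bullet> w)) (at t)"
    by (rule has_field_derivative_transform_within_open[OF _ I])
      (simp add: u hilbert_tensor_product_inner[OF tensor Pi yPi])
  \<comment> \<open>The same real function is differentiated a second time, now through the given
    derivative \<open>u'\<close> of the whole curve; uniqueness of derivatives equates the two
    results.\<close>
  moreover have "((\<lambda>s. u s \<bullet> \<tau> ?y) has_real_derivative u' \<bullet> \<tau> ?y) (at t)"
    by (rule has_derivative_imp_has_field_derivative
        [OF has_derivative_inner_left[OF u'[unfolded has_vector_derivative_def]]]) simp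
  ultimately show ?thesis
    by (rule DERIV_unique[rotated])
qed

section \<open>The scalar linear differential equation\<close>

text \<open>The equation says nothing about \<open>g 0\<close>, and \<open>g\<close> is not assumed
  continuous. Away from 0 it agrees with the continuous quotient of \<open>f'\<close> and
  \<open>f\<close>, so it is integrable with the same integral; an integrating factor then solves
  the equation.\<close>

lemma linear_ode_solution_exp:
  fixes f f' g :: "real \<Rightarrow> real"
  assumes t: "0 \<le> t"
    and f': "\<And>s. s \<in> {0..t} \<Longrightarrow> (f has_real_derivative f' s) (at s within {0..t})"
    and cont: "continuous_on {0..t} f'"
    and nonzero: "\<And>s. s \<in> {0..t} \<Longrightarrow> f s \<noteq> 0"
    and ode: "\<And>s. s \<in> {0<..t} \<Longrightarrow> f' s = f s * g s"
  shows "g integrable_on {0..t}" "f t = f 0 * exp (integral {0..t} g)"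
proof -
  let ?q = "\<lambda>s. f' s / f s"
  have "continuous_on {0..t} f"
    using f' by (intro DERIV_continuous_on)
  then have q: "continuous_on {0..t} ?q"
    using cont nonzero by (intro continuous_on_divide) auto
  have eq: "g s = ?q s" if "s \<in> {0..t} - {0}" for s
    using ode[of s] nonzero[of s] that by simp
  have negl: "negligible {0::real}"
    by simp
  show "g integrable_on {0..t}"
    by (rule integrable_spike[OF integrable_continuous_interval[OF q] negl]) (rule eq)
  have int: "integral {0..t} g = integral {0..t} ?q"
    by (rule integral_spike[OF negl]) (simp add: eq)
  \<comment> \<open>Multiplying by the integrating factor yields a function with zero derivative,
    because \<open>f s * ?q s\<close> is \<open>f' s\<close>.\<close>
  let ?h = "\<lambda>s. f s * exp (- integral {0..s} ?q)"
  have "(?h has_real_derivative 0) (at s within {0..t})" if s: "s \<in> {0..t}" for s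
  proof -
    have "((\<lambda>s. integral {0..s} ?q) has_real_derivative ?q s) (at s within {0..t})"
      using integral_has_real_derivative[OF q s] .
    from DERIV_mult[OF f'[OF s] DERIV_chain2[OF DERIV_exp DERIV_minus[OF this]]]
    show ?thesis
      using nonzero[OF s] by (simp add: field_simps)
  qed
  then have "?h t = ?h 0"
    using has_field_derivative_zero_constant[of "{0..t}" ?h] t by force
  then show "f t = f 0 * exp (integral {0..t} g)"
    by (simp add: int exp_minus field_simps)
qed

section \<open>Equations for the directions and for the scalar factor\<close>

theorem theorem5p7:
  fixes d :: nat and D :: "nat set"
    and V :: "nat \<Rightarrow> 'a::real_inner set"
    and \<tau> :: "(nat \<Rightarrow> 'a) \<Rightarrow> 'h::{real_inner, complete_space}"
    and DA :: "'h set" and A :: "'h \<Rightarrow> 'h"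
    and T lam0 :: real and v0 :: "nat \<Rightarrow> 'a" and u0 :: 'h
    and lam :: "real \<Rightarrow> real" and v :: "real \<Rightarrow> nat \<Rightarrow> 'a" and vr :: "real \<Rightarrow> 'h"
  assumes d: "d \<ge> 2" and D: "D = {1..d}"
    and V: "hilbert_family D V"
    and tensor: "is_hilbert_tensor_product D V \<tau>"
    and A: "densely_defined_linear_operator DA A"
    and flow: "generates_flow DA A"
    and T: "T > 0"
    and v0: "\<forall>\<alpha>\<in>D. v0 \<alpha> \<in> V \<alpha> \<and> norm (v0 \<alpha>) = 1"
    and u0: "u0 = lam0 *\<^sub>R \<tau> v0" "u0 \<in> hartree_manifold D V \<tau>"
    and vr: "\<forall>t\<in>{0..<T}. vr t = lam t *\<^sub>R \<tau> (v t) \<and> vr t \<in> hartree_manifold D V \<tau>"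
    and sphere: "\<forall>t\<in>{0..<T}. \<forall>\<alpha>\<in>D. v t \<alpha> \<in> unit_sphere_in (V \<alpha>)"
    and lam_C1: "C1_within {0..<T} lam"
    and v_C1: "\<forall>\<alpha>\<in>D. C1_within {0..<T} (\<lambda>t. v t \<alpha>)"
    and dom: "\<forall>t\<in>{0<..<T}. vr t \<in> DA"
    and ode: "\<forall>t\<in>{0<..<T}.
      (vr has_vector_derivative metric_projection (hartree_tangent D V \<tau> (v t)) (A (vr t))) (at t)"
    and init: "vr 0 = u0" "lam 0 = lam0"
  shows "(\<forall>t\<in>{0<..<T}. \<forall>\<alpha>\<in>D. \<forall>w\<in>sphere_tangent_in (V \<alpha>) (v t \<alpha>).
            vector_derivative (\<lambda>s. v s \<alpha>) (at t) \<bullet> w - hartree_form A \<tau> (v t) \<alpha> (v t \<alpha>) w = 0) \<and>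
         (\<forall>t\<in>{0..<T}.
            (\<lambda>s. A (\<tau> (v s)) \<bullet> \<tau> (v s)) integrable_on {0..t} \<and>
            lam t = lam0 * exp (integral {0..t} (\<lambda>s. A (\<tau> (v s)) \<bullet> \<tau> (v s))))"
proof -
  have fin: "finite D"
    using D by simp
  obtain lam' where lam': "\<And>t. t \<in> {0..<T} \<Longrightarrow> (lam has_vector_derivative lam' t) (at t within {0..<T})"
    "\<And>t. t \<in> interior {0..<T} \<Longrightarrow> (lam has_vector_derivative lam' t) (at t)"
    "continuous_on {0..<T} lam'"
    using C1_within_obtain[OF lam_C1] by metis
  have "\<forall>\<alpha>\<in>D. \<exists>f'. \<forall>t\<in>interior {0..<T}. ((\<lambda>s. v s \<alpha>) has_vector_derivative f' t) (at t)"
    using v_C1 C1_within_obtain by metis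
  then obtain v' where v': "\<And>\<alpha> t. \<alpha> \<in> D \<Longrightarrow> t \<in> {0<..<T} \<Longrightarrow>
      ((\<lambda>s. v s \<alpha>) has_vector_derivative v' \<alpha> t) (at t)"
    by (metis interior_atLeastLessThan)
  have nonzero: "lam t \<noteq> 0" if "t \<in> {0..<T}" for t
  proof -
    have "0 \<notin> hartree_manifold D V \<tau>"
      by (force simp: hartree_manifold_def)
    then show ?thesis
      using vr that by fastforce
  qed
  have A_scale: "A (vr t) = lam t *\<^sub>R A (\<tau> (v t))" if t: "t \<in> {0<..<T}" for t
  proof -
    have vr_t: "vr t = lam t *\<^sub>R \<tau> (v t)" and lam_t: "lam t \<noteq> 0"
      using t vr nonzero[of t] by auto
    \<comment> \<open>\<open>A\<close> is linear only on \<open>DA\<close>, so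
      \<open>\<tau> (v t)\<close> has to be placed in the domain before the scalar can be pulled
      out; dividing \<open>vr t\<close> by its nonzero factor does this.\<close>
    then have "\<tau> (v t) = inverse (lam t) *\<^sub>R vr t"
      by simp
    then have "\<tau> (v t) \<in> DA"
      using dom t A by (auto simp: densely_defined_linear_operator_def intro: subspace_scale)
    then show ?thesis
      using A vr_t by (simp add: densely_defined_linear_operator_def)
  qed
  \<comment> \<open>The left side is the velocity tested with the tangent vector, the right side is
    \<open>A (vr t)\<close> tested with it; the projection drops out by orthogonality of the
    residual. Both conclusions are special choices of \<open>w\<close>.\<close>
  have key: "lam' t * (v t \<alpha> \<bullet> w) + lam t * (v' \<alpha> t \<bullet> w) =
      lam t * (A (\<tau> (v t)) \<bullet> \<tau> ((v t)(\<alpha> := w)))"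
    if t: "t \<in> {0<..<T}" and \<alpha>: "\<alpha> \<in> D" and w: "w \<in> V \<alpha>"
      and tangent: "\<tau> ((v t)(\<alpha> := w)) \<in> hartree_tangent D V \<tau> (v t)" for t \<alpha> w
  proof -
    let ?P = "metric_projection (hartree_tangent D V \<tau> (v t)) (A (vr t))"
    have "?P \<bullet> \<tau> ((v t)(\<alpha> := w)) = lam' t * (v t \<alpha> \<bullet> w) + lam t * (v' \<alpha> t \<bullet> w)"
    proof (rule hartree_curve_derivative_inner[OF fin tensor _ t])
      show "(lam has_vector_derivative lam' t) (at t)"
        using lam'(2) t by simp
      show "(vr has_vector_derivative ?P) (at t)"
        using ode t by blast
    qed (use sphere vr v' t \<alpha> w in auto)
    moreover have "(A (vr t) - ?P) \<bullet> \<tau> ((v t)(\<alpha> := w)) = 0"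
      using sphere t by (intro hartree_tangent_projection[OF fin V tensor _ tangent]) auto
    ultimately show ?thesis
      using A_scale[OF t] by (simp add: inner_diff_left)
  qed
  have dir: "vector_derivative (\<lambda>s. v s \<alpha>) (at t) \<bullet> w - hartree_form A \<tau> (v t) \<alpha> (v t \<alpha>) w = 0"
    if t: "t \<in> {0<..<T}" and \<alpha>: "\<alpha> \<in> D" and w: "w \<in> sphere_tangent_in (V \<alpha>) (v t \<alpha>)" for t \<alpha> w
  proof -
    have w': "w \<in> V \<alpha>" "v t \<alpha> \<bullet> w = 0" "w \<in> hartree_complement V (v t) \<alpha>"
      using w by (auto simp: sphere_tangent_in_def hartree_complement_alt)
    have "\<tau> ((v t)(\<alpha> := w)) \<in> hartree_tangent D V \<tau> (v t)"
      using sphere t by (intro variation_in_hartree_tangent[OF fin V tensor _ \<alpha> w'(3)]) auto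
    from key[OF t \<alpha> w'(1) this] have "v' \<alpha> t \<bullet> w = A (\<tau> (v t)) \<bullet> \<tau> ((v t)(\<alpha> := w))"
      using nonzero[of t] t w'(2) by simp
    then show ?thesis
      by (simp add: vector_derivative_at[OF v'[OF \<alpha> t]] hartree_form_def)
  qed
  have rate: "lam' t = lam t * (A (\<tau> (v t)) \<bullet> \<tau> (v t))" if t: "t \<in> {0<..<T}" for t
  proof -
    \<comment> \<open>Some position is needed in order to write \<open>\<tau> (v t)\<close> itself
      as a test vector of \<open>key\<close>. Position 1 is available since \<open>d\<close> is
      positive, and the update by \<open>v t 1\<close> changes nothing.\<close>
    have one: "1 \<in> D"
      using d D by simp
    have sph: "\<forall>\<alpha>\<in>D. v t \<alpha> \<in> unit_sphere_in (V \<alpha>)"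
      using sphere t by simp
    have self: "v t 1 \<in> V 1" "v t 1 \<bullet> v t 1 = 1"
      using sph one by (auto simp: unit_sphere_in_def dot_square_norm)
    have tangents: "\<tau> ((v t)(1 := v t 1)) \<in> hartree_tangent D V \<tau> (v t)"
      using base_in_hartree_tangent[OF fin V tensor sph] by simp
    \<comment> \<open>This removes the term with \<open>v'\<close> from \<open>key\<close>, while
      \<open>v t 1 \<bullet> v t 1 = 1\<close> leaves \<open>lam' t\<close> alone on the
      left.\<close>
    have "v' 1 t \<bullet> v t 1 = 0"
      using unit_curve_derivative_orthogonal[of "{0<..<T}", OF _ t _ v'[OF one t]] sphere one
      by (auto simp: unit_sphere_in_def)
    then show ?thesis
      using key[OF t one self(1) tangents] self by simp
  qed
  have "(\<lambda>s. A (\<tau> (v s)) \<bullet> \<tau> (v s)) integrable_on {0..t} \<and>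
      lam t = lam0 * exp (integral {0..t} (\<lambda>s. A (\<tau> (v s)) \<bullet> \<tau> (v s)))"
    if t: "t \<in> {0..<T}" for t
  proof -
    have sub: "{0..t} \<subseteq> {0..<T}"
      using t by auto
    \<comment> \<open>The derivative within the closed interval covers the endpoint 0, where only a
      one-sided derivative is given, whereas \<open>rate\<close> covers the positive times.\<close>
    have deriv: "(lam has_real_derivative lam' s) (at s within {0..t})" if "s \<in> {0..t}" for s
      using has_vector_derivative_within_subset[OF lam'(1) sub] that sub
      by (auto simp: has_real_derivative_iff_has_vector_derivative)
    have "0 \<le> t"
      using t by simp
    note sol = linear_ode_solution_exp[OF this deriv continuous_on_subset[OF lam'(3) sub],
        of "\<lambda>s. A (\<tau> (v s)) \<bullet> \<tau> (v s)"]
    show ?thesis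
      using sol nonzero rate sub t init(2) by auto
  qed
  with dir show ?thesis
    by blast
qed

end
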